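(* Consider an $N$-player discrete-time dynamic game with dynamics $x^{(k+1)}=f^{(k)}(x^{(k)},u_1^{(k)},\dots,u_N^{(k)})$, fixed initial state $x^{(1)}=x_1$, horizon $\mathbb{K}=\{1,\dots,k_E\}$, feature counts $\mu_i(\zeta)\in\mathbb{R}^{p_i}$, costs $J_i(\zeta,\theta_i)=-\theta_i^\top\mu_i(\zeta)$ and true (unknown) parameters $\theta_i^*\in\mathbb{R}^{p_i}$, $i\in\mathbb{P}=\{1,\dots,N\}$. For each player $i\in\mathbb{P}$ consider the family of probability densities on trajectories $$\mathrm{p}(\zeta\mid\theta_i)=\frac{\exp\left(\theta_i^\top\mu_i(\zeta)\right)}{\int\exp\left(\theta_i^\top\mu_i(\zeta')\right)\mathrm{d}\zeta'},\qquad \theta_i\in\mathbb{R}^{p_i}.$$ Let a set of $n_t\ge1$ observed trajectories $\mathcal{D}=\{\tilde\zeta_1,\dots,\tilde\zeta_{n_t}\}$ be given such that $$\mathbb{E}_{\mathrm{p}(\zeta\mid\theta_i^* )}\{\mu_j(\zeta)\}=\frac{1}{n_t}\sum_{l=1}^{n_t}\mu_j(\tilde\zeta_l)\qquad\text{for all } i,j\in\mathbb{P}.$$ For each $i\in\mathbb{P}$ let $\hat\theta_i$ be a maximum likelihood estimator with respect to $\mathcal{D}$, i.e. $$\hat\theta_i\in\underset{\theta_i}{\arg\max}\ \sum_{l=1}^{n_t}\ln \mathrm{p}(\tilde\zeta_l\mid\theta_i).$$ Then $$\mathbb{E}_{\mathrm{p}(\zeta\mid\hat\theta_i)}\{J_j(\zeta,\theta_j^*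 )\}=\mathbb{E}_{\mathrm{p}(\zeta\mid\theta_i^* )}\{J_j(\zeta,\theta_j^* )\}\qquad\text{for all } i,j\in\mathbb{P}.$$
   Context: Setting. There are $N$ players, $\mathbb{P}=\{1,\dots,N\}$, and time steps $\mathbb{K}=\{1,\dots,k_E\}$. The state is $x^{(k)}\in\mathbb{R}^n$, the control of player $i$ is $u_i^{(k)}\in\mathbb{R}^{m_i}$. The dynamics are $x^{(k+1)}=f^{(k)}(x^{(k)},u_1^{(k)},\dots,u_N^{(k)})$ with each $f^{(k)}$ continuously differentiable in all arguments, and the initial state $x^{(1)}=x_1$ is fixed and known. The information structure is open-loop: player strategies depend only on the initial state. Features and costs. Player $i$ has a known feature vector $\eta_i(x,u_1,\dots,u_N)\in\mathbb{R}^{p_i}$ whose components are continuously differentiable in all arguments. A trajectory $\zeta=\{\underline{x},\underline{u}_1,\dots,\underline{u}_N\}$ consists of the state values $\underline{x}=(x^{(k)})_{k\in\mathbb{K}}$ and control values $\underline{u}_i=(u_i^{(k)})_{k\in\mathbb{K}}$ that are feasible for the dynamics. The feature count is $\mu_i(\zeta)=\sum_{k=1}^{k_E}\eta_i(x^{(k)},u_1^{(k)},\dots,u_N^{(k)})\in\mathbb{R}^{p_i}$. Integration over trajectories. The integral $\int\cdot\,\mathrm{d}\zeta$ is over all feasible trajectories. Since the initial state is fixed, a feasible trajectory is determined by the controls $(\underline{u}_1,\dots,\underline{u}_N)\in\mathbb{R}^{k_E(m_1+\dots+m_N)}$, and $\mathrm{d}\zeta$ is understood as Lebesgue measure in these controls.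 Densities and expectations are with respect to this measure. Well-definedness conventions. The parameters considered for player $i$ (including $\theta_i^*$, and the set over which the arg max is taken) are those for which the normalizing integral is finite; the expectations of all feature counts $\mu_j$ under $\mathrm{p}(\zeta\mid\theta_i^* )$ exist and are finite; maximizers $\hat\theta_i$ are assumed to exist. *)

theory Defs
  imports "HOL-Analysis.Analysis"
begin

text \<open>
  The dimensions of the control and feature vectors depend on the player, so these vectors are
  represented by functions on \<open>{1..d}\<close> (extensional, i.e. \<open>undefined\<close> outside), and \<open>\<real>\<^sup>d\<close> is
  \<open>rspace d\<close>. The state space has one fixed dimension and is the type \<open>real ^ 'n\<close>.
\<close>

type_synonym rvec = "nat \<Rightarrow> real"

definition rspace :: "nat \<Rightarrow> rvec set" where
  "rspace d = {1..d} \<rightarrow>\<^sub>E UNIV"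

definition dotp :: "nat \<Rightarrow> rvec \<Rightarrow> rvec \<Rightarrow> real" where
  "dotp d v w = (\<Sum>a = 1..d. v a * w a)"

text \<open>
  A joint control \<open>u\<close> has the control vector \<open>u i\<close> of player \<open>i\<close> as its components. A trajectory
  is a pair \<open>(x, u)\<close> with \<open>x k\<close> the state and \<open>u k\<close> the joint control at time \<open>k\<close>.
\<close>

type_synonym joint_control = "nat \<Rightarrow> rvec"
type_synonym control_seq = "nat \<Rightarrow> joint_control"
type_synonym 'n traj = "(nat \<Rightarrow> (real ^ 'n)) \<times> control_seq"

record ('n::finite) game =
  players :: nat
  horizon :: nat
  cdim :: "nat \<Rightarrow> nat"
  fdim :: "nat \<Rightarrow> nat"
  dyn :: "nat \<Rightarrow> (real ^ 'n) \<Rightarrow> joint_control \<Rightarrow> (real ^ 'n)"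
  init :: "real ^ 'n"
  feat :: "nat \<Rightarrow> (real ^ 'n) \<Rightarrow> joint_control \<Rightarrow> rvec"

definition joint_controls :: "('n::finite) game \<Rightarrow> joint_control set" where
  "joint_controls G = (\<Pi>\<^sub>E i\<in>{1..players G}. rspace (cdim G i))"

definition control_seqs :: "('n::finite) game \<Rightarrow> control_seq set" where
  "control_seqs G = {1..horizon G} \<rightarrow>\<^sub>E joint_controls G"

text \<open>
  Continuous differentiability in all arguments: the derivative with respect to the state and the
  partial derivatives with respect to all scalar control coordinates exist and are jointly
  continuous. Continuity in the control is with respect to the product topology on functions,
  which on \<open>joint_controls G\<close> is the Euclidean one.
\<close>

definition continuously_differentiable ::
    "('n::finite) game \<Rightarrow> ((real ^ 'n) \<Rightarrow> joint_control \<Rightarrow> 'b::real_normed_vector) \<Rightarrow> bool" where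
  "continuously_differentiable G g \<longleftrightarrow>
    (\<exists>Dx :: (real ^ 'n) \<times> joint_control \<Rightarrow> (real ^ 'n) \<Rightarrow>\<^sub>L 'b.
      (\<forall>x. \<forall>u\<in>joint_controls G. ((\<lambda>y. g y u) has_derivative blinfun_apply (Dx (x, u))) (at x)) \<and>
      continuous_on (UNIV \<times> joint_controls G) Dx) \<and>
    (\<forall>i\<in>{1..players G}. \<forall>a\<in>{1..cdim G i}. \<exists>Du :: (real ^ 'n) \<times> joint_control \<Rightarrow> 'b.
      (\<forall>x. \<forall>u\<in>joint_controls G.
        ((\<lambda>t. g x (u(i := (u i)(a := t)))) has_vector_derivative Du (x, u)) (at (u i a))) \<and>
      continuous_on (UNIV \<times> joint_controls G) Du)"

definition dynamic_game :: "('n::finite) game \<Rightarrow> bool" where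
  "dynamic_game G \<longleftrightarrow> players G \<ge> 1 \<and> horizon G \<ge> 1 \<and>
    (\<forall>k\<in>{1..horizon G}. continuously_differentiable G (dyn G k)) \<and>
    (\<forall>i\<in>{1..players G}. \<forall>a\<in>{1..fdim G i}. continuously_differentiable G (\<lambda>x u. feat G i x u a))"

definition feasible :: "('n::finite) game \<Rightarrow> 'n traj \<Rightarrow> bool" where
  "feasible G = (\<lambda>(x, u).
    x \<in> extensional {1..horizon G} \<and> u \<in> control_seqs G \<and> x 1 = init G \<and>
    (\<forall>k\<in>{1..<horizon G}. x (k + 1) = dyn G k (x k) (u k)))"

text \<open>States at the times \<open>1, 2, \<dots>\<close> under given controls; the value at time \<open>0\<close> is a dummy.\<close>

primrec state_at :: "('n::finite) game \<Rightarrow> control_seq \<Rightarrow> nat \<Rightarrow> (real ^ 'n)" where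
  "state_at G u 0 = init G"
| "state_at G u (Suc k) = (if k = 0 then init G else dyn G k (state_at G u k) (u k))"

definition rollout :: "('n::finite) game \<Rightarrow> control_seq \<Rightarrow> 'n traj" where
  "rollout G u = (restrict (state_at G u) {1..horizon G}, u)"

definition control_measure :: "('n::finite) game \<Rightarrow> control_seq measure" where
  "control_measure G =
    (\<Pi>\<^sub>M k\<in>{1..horizon G}. \<Pi>\<^sub>M i\<in>{1..players G}. \<Pi>\<^sub>M a\<in>{1..cdim G i}. (lborel :: real measure))"

text \<open>
  The measure \<open>d\<zeta>\<close>: Lebesgue measure in the controls, transported along the bijection between
  control sequences and feasible trajectories.
\<close>

definition traj_measure :: "('n::finite) game \<Rightarrow> 'n traj measure" where
  "traj_measure G = embed_measure (control_measure G) (rollout G)"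

lemma inj_rollout: "inj (rollout G)"
  by (auto simp: inj_on_def rollout_def)

lemma space_control_measure: "space (control_measure G) = control_seqs G"
  by (simp add: control_measure_def control_seqs_def joint_controls_def rspace_def space_PiM)

lemma rollout_image:
  assumes "horizon G \<ge> 1"
  shows "rollout G ` control_seqs G = {\<zeta>. feasible G \<zeta>}"
proof (intro equalityI subsetI)
  fix \<zeta> assume "\<zeta> \<in> rollout G ` control_seqs G"
  then show "\<zeta> \<in> {\<zeta>. feasible G \<zeta>}"
    using assms by (auto simp: feasible_def rollout_def)
next
  fix \<zeta> assume "\<zeta> \<in> {\<zeta>. feasible G \<zeta>}"
  then obtain x u where xu: "\<zeta> = (x, u)" "feasible G (x, u)" by (cases \<zeta>) auto
  have "Suc k \<le> horizon G \<longrightarrow> x (Suc k) = state_at G u (Suc k)" for k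
    by (induction k) (use xu(2) in \<open>auto simp: feasible_def\<close>)
  then have "x k = state_at G u k" if "k \<in> {1..horizon G}" for k
    using that by (cases k) auto
  then have "x = restrict (state_at G u) {1..horizon G}"
    using xu(2) by (intro extensionalityI[of _ "{1..horizon G}"]) (auto simp: feasible_def)
  then show "\<zeta> \<in> rollout G ` control_seqs G"
    using xu by (auto simp: rollout_def feasible_def)
qed

lemma space_traj_measure: "horizon G \<ge> 1 \<Longrightarrow> space (traj_measure G) = {\<zeta>. feasible G \<zeta>}"
  by (simp add: traj_measure_def space_embed_measure space_control_measure rollout_image)

lemma integral_traj_measure:
  fixes g :: "('n::finite) traj \<Rightarrow> real"
  shows "(\<integral>\<zeta>. g \<zeta> \<partial>traj_measure G) = (\<integral>u. g (rollout G u) \<partial>control_measure G)"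
proof (cases "g \<in> borel_measurable (traj_measure G)")
  case True
  have "traj_measure G = distr (control_measure G) (traj_measure G) (rollout G)"
    unfolding traj_measure_def by (rule embed_measure_eq_distr[OF inj_rollout])
  moreover have "rollout G \<in> measurable (control_measure G) (traj_measure G)"
    unfolding traj_measure_def by (rule measurable_embed_measure2[OF inj_rollout])
  ultimately show ?thesis using True by (metis integral_distr)
next
  case False
  then have "(\<lambda>u. g (rollout G u)) \<notin> borel_measurable (control_measure G)"
    unfolding traj_measure_def using measurable_embed_measure1 by blast
  then show ?thesis using False
    by (metis borel_measurable_integrable not_integrable_integral_eq)
qed

definition feature_count :: "('n::finite) game \<Rightarrow> nat \<Rightarrow> 'n traj \<Rightarrow> rvec" where
  "feature_count G i = (\<lambda>(x, u). \<lambda>a\<in>{1..fdim G i}. \<Sum>k = 1..horizon G. feat G i (x k) (u k) a)"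

definition cost :: "('n::finite) game \<Rightarrow> nat \<Rightarrow> rvec \<Rightarrow> 'n traj \<Rightarrow> real" where
  "cost G i \<theta> \<zeta> = - dotp (fdim G i) \<theta> (feature_count G i \<zeta>)"

definition weight :: "('n::finite) game \<Rightarrow> nat \<Rightarrow> rvec \<Rightarrow> 'n traj \<Rightarrow> real" where
  "weight G i \<theta> \<zeta> = exp (dotp (fdim G i) \<theta> (feature_count G i \<zeta>))"

text \<open>Parameters in \<open>\<real>\<^sup>p\<close>, \<open>p = fdim G i\<close>, with finite normalizing integral.\<close>

definition params :: "('n::finite) game \<Rightarrow> nat \<Rightarrow> rvec set" where
  "params G i = {\<theta> \<in> rspace (fdim G i). integrable (traj_measure G) (weight G i \<theta>)}"

definition traj_density :: "('n::finite) game \<Rightarrow> nat \<Rightarrow> rvec \<Rightarrow> 'n traj \<Rightarrow> real" where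
  "traj_density G i \<theta> \<zeta> = weight G i \<theta> \<zeta> / (\<integral>\<zeta>'. weight G i \<theta> \<zeta>' \<partial>traj_measure G)"

definition traj_distr :: "('n::finite) game \<Rightarrow> nat \<Rightarrow> rvec \<Rightarrow> 'n traj measure" where
  "traj_distr G i \<theta> = density (traj_measure G) (\<lambda>\<zeta>. ennreal (traj_density G i \<theta> \<zeta>))"

definition log_likelihood ::
    "('n::finite) game \<Rightarrow> nat \<Rightarrow> nat \<Rightarrow> (nat \<Rightarrow> 'n traj) \<Rightarrow> rvec \<Rightarrow> real" where
  "log_likelihood G i nt D \<theta> = (\<Sum>l = 1..nt. ln (traj_density G i \<theta> (D l)))"

definition is_MLE ::
    "('n::finite) game \<Rightarrow> nat \<Rightarrow> nat \<Rightarrow> (nat \<Rightarrow> 'n traj) \<Rightarrow> rvec \<Rightarrow> bool" where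
  "is_MLE G i nt D \<theta> \<longleftrightarrow> is_arg_max (log_likelihood G i nt D) (\<lambda>\<theta>'. \<theta>' \<in> params G i) \<theta>"

end

theory Submission
  imports Defs
begin

text \<open>
  The matching condition for \<open>j = i\<close> turns the mean log-likelihood of \<open>\<theta>\<close> into the cross entropy
  \<open>E\<^bsub>p(\<theta>\<^sub>i\<^sup>*)\<^esub>[ln p(\<theta>)]\<close>. By Gibbs' inequality \<open>\<theta>\<^sub>i\<^sup>*\<close> maximizes it, and any other maximizer has
  almost everywhere the same density. So the two distributions coincide, and with them all
  expectations.
\<close>

text \<open>The equality case of Gibbs' inequality: the integral assumed nonnegative in
  \<open>nonneg\<close> is minus the Kullback-Leibler divergence of \<open>p\<close> from
  \<open>q\<close>, which for equal masses can only be nonpositive. \<open>AE\<close> equality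
  follows from the equality case of ln t \<le> t - 1 at t = \<open>q x / p x\<close>.\<close>

lemma Gibbs_equality:
  fixes p q :: "'a \<Rightarrow> real"
  assumes pos: "\<And>x. p x > 0" "\<And>x. q x > 0"
    and p: "integrable M p" and q: "integrable M q"
    and eq: "(\<integral>x. p x \<partial>M) = (\<integral>x. q x \<partial>M)"
    and int: "integrable M (\<lambda>x. p x * (ln (q x) - ln (p x)))"
    and nonneg: "(\<integral>x. p x * (ln (q x) - ln (p x)) \<partial>M) \<ge> 0"
  shows "AE x in M. p x = q x"
proof -
  \<comment> \<open>The term \<open>q x - p x\<close> integrates to zero by \<open>eq\<close> and
    makes the integrand pointwise nonnegative, so that a vanishing integral forces \<open>h\<close>
    to vanish almost everywhere.\<close>
  define h where "h x = q x - p x - p x * (ln (q x) - ln (p x))" for x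
  have h_eq: "h x = p x * (q x / p x - 1 - ln (q x / p x))" for x
    using pos[of x] by (simp add: h_def ln_div field_simps)
  have h_nonneg: "h x \<ge> 0" for x
    unfolding h_eq using pos[of x] ln_le_minus_one[of "q x / p x"] by simp
  have h_int: "integrable M h"
    unfolding h_def using p q int by (intro Bochner_Integration.integrable_diff)
  have "(\<integral>x. h x \<partial>M) = (\<integral>x. q x \<partial>M) - (\<integral>x. p x \<partial>M) - (\<integral>x. p x * (ln (q x) - ln (p x)) \<partial>M)"
    unfolding h_def using p q int by simp
  then have "(\<integral>x. h x \<partial>M) \<le> 0"
    using nonneg eq by linarith
  moreover have "(\<integral>x. h x \<partial>M) \<ge> 0"
    using h_nonneg by simp
  ultimately have "(\<integral>x. h x \<partial>M) = 0"
    by (rule antisym)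
  then have "AE x in M. h x = 0"
    using integral_nonneg_eq_0_iff_AE[OF h_int] h_nonneg by simp
  then show ?thesis
  proof (rule AE_mp, intro AE_I2 impI)
    fix x assume "h x = 0"
    then have "ln (q x / p x) = q x / p x - 1"
      using pos[of x] by (simp add: h_eq)
    then have "q x / p x = 1"
      using pos[of x] by (intro ln_eq_minus_one) auto
    then show "p x = q x" using pos[of x] by simp
  qed
qed

lemma ln_traj_density:
  assumes "integral\<^sup>L (traj_measure G) (weight G i \<theta>) > 0"
  shows "ln (traj_density G i \<theta> \<zeta>) = dotp (fdim G i) \<theta> (feature_count G i \<zeta>)
    - ln (integral\<^sup>L (traj_measure G) (weight G i \<theta>))"
proof -
  have "weight G i \<theta> \<zeta> > 0" "ln (weight G i \<theta> \<zeta>) = dotp (fdim G i) \<theta> (feature_count G i \<zeta>)"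
    by (simp_all add: weight_def)
  with assms show ?thesis by (simp add: traj_density_def ln_div)
qed

text \<open>The log-density is linear in the feature count up to the normalizer, so the data enter
  the likelihood only through the empirical mean of the features, the quantity that the matching
  condition prescribes.\<close>

lemma log_likelihood_eq:
  assumes "integral\<^sup>L (traj_measure G) (weight G i \<theta>) > 0" and "nt \<ge> 1"
  shows "log_likelihood G i nt D \<theta> = real nt *
    (dotp (fdim G i) \<theta> (\<lambda>a. 1 / real nt * (\<Sum>l = 1..nt. feature_count G i (D l) a))
      - ln (integral\<^sup>L (traj_measure G) (weight G i \<theta>)))"
proof -
  have "(\<Sum>l = 1..nt. dotp (fdim G i) \<theta> (feature_count G i (D l))) =
      (\<Sum>a = 1..fdim G i. \<theta> a * (\<Sum>l = 1..nt. feature_count G i (D l) a))"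
    unfolding dotp_def by (subst sum.swap) (simp add: sum_distrib_left)
  also have "\<dots> = real nt *
      dotp (fdim G i) \<theta> (\<lambda>a. 1 / real nt * (\<Sum>l = 1..nt. feature_count G i (D l) a))"
    using assms(2) by (simp add: dotp_def sum_distrib_left)
  finally show ?thesis
    by (simp add: log_likelihood_def ln_traj_density[OF assms(1)] sum_subtractf right_diff_distrib)
qed

text \<open>The log-ratio of the two densities is affine in the feature count of player
  \<open>i\<close>. Its expectation under \<open>\<theta>\<close> is therefore determined by
  matching and equals the gain in mean log-likelihood from \<open>\<theta>\<close> to
  \<open>\<theta>'\<close>, which is nonnegative for a maximizer; \<open>Gibbs_equality\<close>
  applies.\<close>

lemma traj_distr_MLE_eq:
  fixes G :: "('n::finite) game"
  assumes \<theta>: "\<theta> \<in> params G i"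
    and nt: "nt \<ge> 1"
    and fin: "\<And>a. a \<in> {1..fdim G i} \<Longrightarrow>
      integrable (traj_distr G i \<theta>) (\<lambda>\<zeta>. feature_count G i \<zeta> a)"
    and matching: "\<And>a. a \<in> {1..fdim G i} \<Longrightarrow>
      (\<integral>\<zeta>. feature_count G i \<zeta> a \<partial>traj_distr G i \<theta>) =
        1 / real nt * (\<Sum>l = 1..nt. feature_count G i (D l) a)"
    and mle: "is_MLE G i nt D \<theta>'"
  shows "traj_distr G i \<theta>' = traj_distr G i \<theta>"
proof -
  let ?M = "traj_measure G" and ?p = "traj_density G i \<theta>" and ?q = "traj_density G i \<theta>'"
  define Z where "Z \<phi> = integral\<^sup>L ?M (weight G i \<phi>)" for \<phi>
  have \<theta>': "\<theta>' \<in> params G i" and le: "log_likelihood G i nt D \<theta> \<le> log_likelihood G i nt D \<theta>'"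
    using mle \<theta> by (auto simp: is_MLE_def is_arg_max_linorder)
  have w: "integrable ?M (weight G i \<theta>)" "integrable ?M (weight G i \<theta>')"
    using \<theta> \<theta>' by (auto simp: params_def)
  have dens_int: "integrable ?M ?p" "integrable ?M ?q"
    unfolding traj_density_def using w by simp_all
  \<comment> \<open>Over a null measure the claim is vacuous. Otherwise the integral of the strictly
    positive weight cannot vanish, so the normalizers are positive and the densities are
    genuine.\<close>
  have "AE \<zeta> in ?M. ?p \<zeta> = ?q \<zeta>"
  proof (cases "AE \<zeta> in ?M. False")
    case True
    then show ?thesis by (rule AE_mp) simp
  next
    case False
    have Z_pos: "Z \<phi> > 0" if "integrable ?M (weight G i \<phi>)" for \<phi>
    proof -
      have "Z \<phi> \<noteq> 0"
        unfolding Z_def using False integral_nonneg_eq_0_iff_AE[OF that] by (simp add: weight_def)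
      moreover have "Z \<phi> \<ge> 0"
        unfolding Z_def by (simp add: weight_def)
      ultimately show ?thesis by simp
    qed
    have Z: "Z \<theta> > 0" "Z \<theta>' > 0" using Z_pos w by auto
    have pos: "?p \<zeta> > 0" "?q \<zeta> > 0" for \<zeta>
      using Z by (auto simp: traj_density_def Z_def weight_def[of G i _ \<zeta>] intro!: divide_pos_pos)
    have one: "(\<integral>\<zeta>. ?p \<zeta> \<partial>?M) = 1" "(\<integral>\<zeta>. ?q \<zeta> \<partial>?M) = 1"
      using Z by (simp_all add: traj_density_def Z_def)
    define m where "m a = 1 / real nt * (\<Sum>l = 1..nt. feature_count G i (D l) a)" for a
    let ?dot = "dotp (fdim G i)" and ?\<mu> = "feature_count G i"
    \<comment> \<open>The log-ratio ln (q / p), written out in the feature count so that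
      integrability and expectation can be read off from \<open>fin\<close> and
      \<open>matching\<close>.\<close>
    define L where "L \<zeta> = ?dot \<theta>' (?\<mu> \<zeta>) - ?dot \<theta> (?\<mu> \<zeta>) - (ln (Z \<theta>') - ln (Z \<theta>))" for \<zeta>
    have L_eq: "ln (?q \<zeta>) - ln (?p \<zeta>) = L \<zeta>" for \<zeta>
      using ln_traj_density[of G i \<theta> \<zeta>] ln_traj_density[of G i \<theta>' \<zeta>] Z by (simp add: L_def Z_def)
    let ?P = "traj_distr G i \<theta>"
    have dens_meas: "?p \<in> borel_measurable ?M" using dens_int by auto
    have AE_pos: "AE \<zeta> in ?M. 0 \<le> ?p \<zeta>"
      using pos by (simp add: less_imp_le)
    \<comment> \<open>That \<open>?P\<close> has total mass 1, in the form needed for the constant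
      \<open>ln (Z \<theta>') - ln (Z \<theta>)\<close> in \<open>L\<close>.\<close>
    have P_space: "integrable ?P (\<lambda>_. c)" "(\<integral>\<zeta>. c \<partial>?P) = c" for c :: real
    proof -
      show "integrable ?P (\<lambda>_. c)"
        unfolding traj_distr_def
        by (subst integrable_density[OF _ dens_meas AE_pos]) (use dens_int in auto)
      have "(\<integral>\<zeta>. c \<partial>?P) = (\<integral>\<zeta>. ?p \<zeta> *\<^sub>R c \<partial>?M)"
        unfolding traj_distr_def by (rule integral_density[OF _ dens_meas AE_pos]) simp
      also have "\<dots> = (\<integral>\<zeta>. ?p \<zeta> \<partial>?M) * c"
        by simp
      finally show "(\<integral>\<zeta>. c \<partial>?P) = c" using one by simp
    qed
    have dot_int: "integrable ?P (\<lambda>\<zeta>. ?dot \<phi> (?\<mu> \<zeta>))" for \<phi>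
      unfolding dotp_def using fin by (intro Bochner_Integration.integrable_sum) auto
    \<comment> \<open>Matching enters here: the expectation is taken under \<open>\<theta>\<close>,
      but the coefficient vector \<open>\<phi>\<close> is free, so the identity also covers
      \<open>\<theta>'\<close>.\<close>
    have dot_val: "(\<integral>\<zeta>. ?dot \<phi> (?\<mu> \<zeta>) \<partial>?P) = ?dot \<phi> m" for \<phi>
    proof -
      have "(\<integral>\<zeta>. ?dot \<phi> (?\<mu> \<zeta>) \<partial>?P) = (\<Sum>a = 1..fdim G i. \<integral>\<zeta>. \<phi> a * ?\<mu> \<zeta> a \<partial>?P)"
        unfolding dotp_def using fin by (intro Bochner_Integration.integral_sum) auto
      also have "\<dots> = ?dot \<phi> m"
        unfolding dotp_def m_def by (intro sum.cong) (simp_all add: matching)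
      finally show ?thesis .
    qed
    have L_int: "integrable ?P L"
      unfolding L_def using dot_int P_space(1) by (intro Bochner_Integration.integrable_diff)
    have L_meas: "L \<in> borel_measurable ?M"
      using L_int unfolding traj_distr_def by auto
    have L_val: "(\<integral>\<zeta>. L \<zeta> \<partial>?P) = (?dot \<theta>' m - ln (Z \<theta>')) - (?dot \<theta> m - ln (Z \<theta>))"
      unfolding L_def using dot_int P_space P_space(2)[of 1] by (simp add: dot_val)
    \<comment> \<open>Optimality of \<open>\<theta>'\<close> against the competitor
      \<open>\<theta>\<close>; dividing by \<open>real nt\<close> leaves exactly the two terms of
      \<open>L_val\<close>.\<close>
    have "real nt * (?dot \<theta> m - ln (Z \<theta>)) \<le> real nt * (?dot \<theta>' m - ln (Z \<theta>'))"
      using le log_likelihood_eq[of G i \<theta> nt D] log_likelihood_eq[of G i \<theta>' nt D] Z nt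
      by (simp add: Z_def m_def[abs_def])
    then have "(\<integral>\<zeta>. L \<zeta> \<partial>?P) \<ge> 0"
      using nt by (simp add: L_val)
    then have L_nonneg: "(\<integral>\<zeta>. ?p \<zeta> * L \<zeta> \<partial>?M) \<ge> 0"
      unfolding traj_distr_def using integral_density[OF L_meas dens_meas AE_pos] by simp
    have "integrable ?M (\<lambda>\<zeta>. ?p \<zeta> * L \<zeta>)"
      using L_int unfolding traj_distr_def
      using integrable_density[OF L_meas dens_meas AE_pos] by simp
    then show ?thesis
      using Gibbs_equality[OF pos dens_int] one L_nonneg by (simp add: L_eq)
  qed
  then show ?thesis
    unfolding traj_distr_def using dens_int
    by (intro density_cong) (auto elim!: AE_mp)
qed

theorem theorem2:
  fixes G :: "('n::finite) game"
    and \<theta>s \<theta>h :: "nat \<Rightarrow> rvec"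
    and nt :: nat and D :: "nat \<Rightarrow> 'n traj"
  assumes game: "dynamic_game G"
    and true_params: "\<And>i. i \<in> {1..players G} \<Longrightarrow> \<theta>s i \<in> params G i"
    and nt: "nt \<ge> 1"
    and obs: "\<And>l. l \<in> {1..nt} \<Longrightarrow> feasible G (D l)"
    and finite_expectation: "\<And>i j a. i \<in> {1..players G} \<Longrightarrow> j \<in> {1..players G} \<Longrightarrow> a \<in> {1..fdim G j} \<Longrightarrow>
      integrable (traj_distr G i (\<theta>s i)) (\<lambda>\<zeta>. feature_count G j \<zeta> a)"
    and matching: "\<And>i j a. i \<in> {1..players G} \<Longrightarrow> j \<in> {1..players G} \<Longrightarrow> a \<in> {1..fdim G j} \<Longrightarrow>
      (\<integral>\<zeta>. feature_count G j \<zeta> a \<partial>traj_distr G i (\<theta>s i)) =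
        1 / real nt * (\<Sum>l = 1..nt. feature_count G j (D l) a)"
    and mle: "\<And>i. i \<in> {1..players G} \<Longrightarrow> is_MLE G i nt D (\<theta>h i)"
  shows "\<forall>i\<in>{1..players G}. \<forall>j\<in>{1..players G}.
    integrable (traj_distr G i (\<theta>h i)) (cost G j (\<theta>s j)) \<and>
    (\<integral>\<zeta>. cost G j (\<theta>s j) \<zeta> \<partial>traj_distr G i (\<theta>h i)) =
      (\<integral>\<zeta>. cost G j (\<theta>s j) \<zeta> \<partial>traj_distr G i (\<theta>s i))"
proof (intro ballI)
  fix i j assume ij: "i \<in> {1..players G}" "j \<in> {1..players G}"
  have "traj_distr G i (\<theta>h i) = traj_distr G i (\<theta>s i)"
    using ij true_params nt finite_expectation matching mle by (intro traj_distr_MLE_eq)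
  \<comment> \<open>Integrability is checked under the true parameter, where the feature counts of
    every player have finite expectation, and carries over because the two distributions are equal
    as measures.\<close>
  moreover have "integrable (traj_distr G i (\<theta>s i)) (cost G j (\<theta>s j))"
    unfolding cost_def dotp_def using finite_expectation ij
    by (intro Bochner_Integration.integrable_minus Bochner_Integration.integrable_sum) auto
  ultimately show "integrable (traj_distr G i (\<theta>h i)) (cost G j (\<theta>s j)) \<and>
    (\<integral>\<zeta>. cost G j (\<theta>s j) \<zeta> \<partial>traj_distr G i (\<theta>h i)) =
      (\<integral>\<zeta>. cost G j (\<theta>s j) \<zeta> \<partial>traj_distr G i (\<theta>s i))"
    by simp
qed

end
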